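(* Let $f:I\rightarrow[0,\infty)$ be any corner density. Then for any $\lambda>0$ the function $h:\lambda I\rightarrow[0,\infty)$ defined by $h(z)=\frac{1}{\lambda}f\left(\frac{z}{\lambda}\right)$ for $z\in\lambda I$ is a corner density with the same genial entropy as $f$.
   Context: A corner density is a function $f:I\rightarrow[0,\infty)$ where $I\cup\{0\}$ is a connected interval contained in $[0,\infty)$, $f$ is monotone decreasing (not necessarily strictly), and $\int_I f\,dx=1$. The genial entropy of a corner density $f:I\rightarrow[0,\infty)$ is $G(f)=-1-\int_I f(x)\ln(xf(x))\,dx$ when this integral exists, with the convention $0\ln(0)=0$. Here $\lambda I=\{\lambda x : x\in I\}$. *)

theory Defs
  imports "HOL-Analysis.Analysis"
begin

text \<open>
  A function \<open>f : I \<rightarrow> [0, \<infinity>)\<close> is a total function together with its domain \<open>I\<close>;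
  its values outside \<open>I\<close> are irrelevant.  All integrals are Lebesgue integrals over \<open>I\<close>.
\<close>

definition corner_density :: "real set \<Rightarrow> (real \<Rightarrow> real) \<Rightarrow> bool" where
  "corner_density I f \<longleftrightarrow>
     is_interval (I \<union> {0}) \<and> I \<union> {0} \<subseteq> {0..} \<and>
     (\<forall>x\<in>I. 0 \<le> f x) \<and> antimono_on I f \<and>
     set_integrable lborel I f \<and> (LBINT x:I. f x) = 1"

text \<open>
  The convention \<open>0 ln 0 = 0\<close> holds because of the factor \<open>f x\<close>; the point \<open>x = 0\<close>, which may
  belong to \<open>I\<close>, is a null set.  Existence is stated separately, since the Bochner integral
  of a non-integrable function is \<open>0\<close>.
\<close>

definition genial_entropy_exists :: "real set \<Rightarrow> (real \<Rightarrow> real) \<Rightarrow> bool" where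
  "genial_entropy_exists I f \<longleftrightarrow> set_integrable lborel I (\<lambda>x. f x * ln (x * f x))"

definition genial_entropy :: "real set \<Rightarrow> (real \<Rightarrow> real) \<Rightarrow> real" where
  "genial_entropy I f = - 1 - (LBINT x:I. f x * ln (x * f x))"

end

theory Submission imports Defs begin

text \<open>
  Both the total mass and the entropy integrand are compatible with the dilation \<open>x \<mapsto> l x\<close>.
  The function \<open>h\<close> is the density of the push-forward of \<open>f\<close>, so \<open>h (l x) = f x / l\<close>.  The
  product \<open>z h(z)\<close> inside the logarithm is dilation invariant, because at \<open>z = l x\<close> the
  Jacobian factor \<open>1 / l\<close> cancels against the factor \<open>l\<close> in \<open>z\<close>.  Hence the entropy
  integrand at \<open>l x\<close> is again \<open>1 / l\<close> times the original integrand at \<open>x\<close>.  A single change of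
  variables, in \<open>set_integrable_dilation\<close> and \<open>set_integral_dilation\<close>, therefore transports
  integrability and the value of the integral for both; the order-theoretic conditions on a
  corner density carry over because the dilation is an increasing bijection that fixes \<open>0\<close>.
\<close>

text \<open>
  The relation \<open>k (l x) = g x / l\<close> is the one between densities of a measure and of its
  push-forward; it is required on \<open>I\<close> only, since the functions are arbitrary elsewhere.
  The offset \<open>0\<close> makes the left-hand side an instance of the affine substitution
  \<open>x \<mapsto> t + l x\<close> for Lebesgue measure.
\<close>

lemma indicator_dilation:
  fixes I :: "real set"
  assumes "l \<noteq> 0" and "\<And>x. x \<in> I \<Longrightarrow> k (l * x) = g x / l"
  shows "(\<lambda>x. indicator ((\<lambda>x. l * x) ` I) (0 + l * x) *\<^sub>R k (0 + l * x))
    = (\<lambda>x. indicator I x *\<^sub>R g x / (l :: real))"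
  using assms by (auto simp: indicator_def fun_eq_iff)

lemma set_integrable_dilation:
  fixes I :: "real set" and g k :: "real \<Rightarrow> real"
  assumes "l \<noteq> 0" and "\<And>x. x \<in> I \<Longrightarrow> k (l * x) = g x / l"
  shows "set_integrable lborel ((\<lambda>x. l * x) ` I) k \<longleftrightarrow> set_integrable lborel I g"
proof -
  have "set_integrable lborel ((\<lambda>x. l * x) ` I) k
    \<longleftrightarrow> integrable lborel (\<lambda>x. indicator I x *\<^sub>R g x / l)"
    using indicator_dilation[of l I k g, OF assms] lborel_integrable_real_affine_iff[OF assms(1),
        of "\<lambda>z. indicator ((\<lambda>x. l * x) ` I) z *\<^sub>R k z" 0]
    unfolding set_integrable_def by simp
  also have "\<dots> \<longleftrightarrow> set_integrable lborel I g"
    using assms(1) integrable_mult_right_iff[of lborel "\<lambda>x. indicator I x * g x" "inverse l"]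
    by (simp add: set_integrable_def divide_inverse)
  finally show ?thesis .
qed

lemma set_integral_dilation:
  fixes I :: "real set" and g k :: "real \<Rightarrow> real"
  assumes "l > 0" and "\<And>x. x \<in> I \<Longrightarrow> k (l * x) = g x / l"
  shows "(LBINT z:(\<lambda>x. l * x) ` I. k z) = (LBINT x:I. g x)"
proof -
  have nz: "l \<noteq> 0" using assms(1) by simp
  have "(LBINT z:(\<lambda>x. l * x) ` I. k z)
    = \<bar>l\<bar> *\<^sub>R (LBINT x. indicator I x *\<^sub>R g x / l)"
    using indicator_dilation[of l I k g, OF nz assms(2)] lborel_integral_real_affine[OF nz,
        of "\<lambda>z. indicator ((\<lambda>x. l * x) ` I) z *\<^sub>R k z" 0]
    unfolding set_lebesgue_integral_def by simp
  then show ?thesis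
    using assms(1) by (simp add: set_lebesgue_integral_def)
qed

lemma is_interval_dilation:
  fixes S :: "real set"
  assumes "is_interval S"
  shows "is_interval ((\<lambda>x. l * x) ` S)"
  using assms
  by (simp add: is_interval_convex_1 convex_scaling[where 'a = real, simplified])

lemma corner_density_dilation:
  assumes f: "corner_density I f" and l: "l > 0"
    and h: "\<And>x. x \<in> I \<Longrightarrow> h (l * x) = f x / l"
  shows "corner_density ((\<lambda>x. l * x) ` I) h"
proof -
  have nz: "l \<noteq> 0" using l by simp
  \<comment> \<open>Adjoining \<open>0\<close> commutes with the dilation because \<open>0\<close> is its fixed point.\<close>
  have im: "(\<lambda>x. l * x) ` I \<union> {0} = (\<lambda>x. l * x) ` (I \<union> {0})"
    by auto
  have "is_interval ((\<lambda>x. l * x) ` I \<union> {0})"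
    unfolding im using f by (intro is_interval_dilation) (simp add: corner_density_def)
  moreover have "(\<lambda>x. l * x) ` I \<union> {0} \<subseteq> {0..}"
    using f l by (auto simp: corner_density_def)
  moreover have "\<forall>z\<in>(\<lambda>x. l * x) ` I. 0 \<le> h z"
    using f l by (auto simp: corner_density_def h)
  moreover have "antimono_on ((\<lambda>x. l * x) ` I) h"
    using f l by (auto simp: corner_density_def monotone_on_def h divide_right_mono)
  moreover have "set_integrable lborel ((\<lambda>x. l * x) ` I) h"
    using f set_integrable_dilation[of l I h f, OF nz h] by (simp add: corner_density_def)
  moreover have "(LBINT z:(\<lambda>x. l * x) ` I. h z) = 1"
    using f set_integral_dilation[of l I h f, OF l h] by (simp add: corner_density_def)
  ultimately show ?thesis
    by (simp add: corner_density_def)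
qed

theorem theorem1:
  fixes I :: "real set" and f h :: "real \<Rightarrow> real" and l :: real
  assumes "corner_density I f"
    and "l > 0"
    and "\<And>z. z \<in> (\<lambda>x. l * x) ` I \<Longrightarrow> h z = 1 / l * f (z / l)"
  shows "corner_density ((\<lambda>x. l * x) ` I) h
    \<and> (genial_entropy_exists ((\<lambda>x. l * x) ` I) h \<longleftrightarrow> genial_entropy_exists I f)
    \<and> (genial_entropy_exists I f \<longrightarrow>
         genial_entropy ((\<lambda>x. l * x) ` I) h = genial_entropy I f)"
proof -
  have nz: "l \<noteq> 0" using assms(2) by simp
  have h: "h (l * x) = f x / l" if "x \<in> I" for x
    using assms(3)[of "l * x"] that nz by simp
  \<comment> \<open>The logarithms agree exactly: \<open>(l x) h(l x) = x f(x)\<close>.\<close>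
  have ent: "h (l * x) * ln (l * x * h (l * x)) = f x * ln (x * f x) / l" if "x \<in> I" for x
    using nz by (simp add: h[OF that])
  have "genial_entropy_exists ((\<lambda>x. l * x) ` I) h \<longleftrightarrow> genial_entropy_exists I f"
    unfolding genial_entropy_exists_def
    using set_integrable_dilation[where k = "\<lambda>z. h z * ln (z * h z)"
        and g = "\<lambda>x. f x * ln (x * f x)", OF nz ent] by simp
  moreover have "genial_entropy ((\<lambda>x. l * x) ` I) h = genial_entropy I f"
    unfolding genial_entropy_def
    using set_integral_dilation[where k = "\<lambda>z. h z * ln (z * h z)"
        and g = "\<lambda>x. f x * ln (x * f x)", OF assms(2) ent] by simp
  ultimately show ?thesis
    using corner_density_dilation[of I f l h, OF assms(1,2) h] by simp
qed

end
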